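(* Let $\Bbbk$ be a field and let $n \ge 9$ be an integer such that $\binom{n}{3}$ is even. For $i \in \{1,2,3\}$ let $S_i = \{x_j \mid 1 \le j \le n,\ j \equiv i \pmod 3\}$, with subscripts of $S$ read modulo 3. Define the following sets of squarefree monomials of degree 3 in $\Bbbk[x_1,\dots,x_n]$ (products of three distinct variables): - $G_1 = \{x_u x_v x_w \mid x_u, x_v, x_w \in S_i \text{ for some } i \in \{1,2,3\}\}$; - $G_2 = \{x_u x_v x_w \mid x_u, x_v \in S_i,\ x_w \in S_{i+1} \text{ for some } i \in \{1,2,3\}\}$; - $G_3$: any set of exactly $\frac12\binom{n}{3} - \#G_1 - \#G_2$ squarefree monomials of degree 3 not belonging to $G_1 \cup G_2$. Then the ideal $I = \langle G_1 \cup G_2 \cup G_3\rangle$ is an $f$-ideal.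
   Context: Let $I \subseteq \Bbbk[x_1,\dots,x_n]$ be a squarefree monomial ideal whose minimal monomial generators all have degree at least 2. Identify a subset $F \subseteq \{x_1,\dots,x_n\}$ with the squarefree monomial $x_F = \prod_{x_i \in F} x_i$. The Stanley-Reisner complex $\Delta_I$ is the simplicial complex whose faces are the sets $F$ with $x_F \notin I$. The facet complex $\Delta(I)$ is the simplicial complex whose facets are the sets $F$ such that $x_F$ is a minimal generator of $I$; that is, its faces are the sets $F$ such that $x_F$ divides some minimal generator of $I$. The $f$-vector of a simplicial complex of dimension $e$ is $(f_{-1},f_0,\dots,f_e)$, where $f_i$ is the number of faces with $i+1$ elements ($f_{-1}=1$ for a nonempty complex). The ideal $I$ is called an $f$-ideal if $\Delta_I$ and $\Delta(I)$ have the same $f$-vector. *)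

theory Defs
  imports "HOL-Library.Poly_Mapping" "HOL-Algebra.Ideal" "HOL-Algebra.Divisibility"
begin

text \<open>
  A power product is a finitely supported exponent vector \<open>nat \<Rightarrow>\<^sub>0 nat\<close>, and a polynomial is a
  finitely supported family of coefficients on power products. The type provides infinitely many
  indeterminates; \<open>mpoly_ring n\<close> is the ring in the indeterminates with indices \<open>1, \<dots>, n\<close>.
\<close>

type_synonym 'k mpoly = "(nat \<Rightarrow>\<^sub>0 nat) \<Rightarrow>\<^sub>0 'k"

definition mpoly_ring :: "nat \<Rightarrow> 'k::comm_ring_1 mpoly ring" where
  "mpoly_ring n =
    \<lparr>carrier = {p. \<forall>m \<in> Poly_Mapping.keys p. Poly_Mapping.keys m \<subseteq> {1..n}},
     monoid.mult = (*), one = 1, zero = 0, add = (+)\<rparr>"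

definition mono_of :: "(nat \<Rightarrow>\<^sub>0 nat) \<Rightarrow> 'k::comm_ring_1 mpoly" where
  "mono_of m = Poly_Mapping.single m 1"

definition var :: "nat \<Rightarrow> 'k::comm_ring_1 mpoly" where
  "var j = mono_of (Poly_Mapping.single j 1)"

definition monomials :: "nat \<Rightarrow> 'k::comm_ring_1 mpoly set" where
  "monomials n = {mono_of m | m. Poly_Mapping.keys m \<subseteq> {1..n}}"

definition mono_degree :: "(nat \<Rightarrow>\<^sub>0 nat) \<Rightarrow> nat" where
  "mono_degree m = (\<Sum>j\<in>Poly_Mapping.keys m. Poly_Mapping.lookup m j)"

text \<open>The squarefree monomial \<open>x\<^sub>F\<close>; a set of variables is represented by its set of indices.\<close>

definition sqfree_mono :: "nat set \<Rightarrow> 'k::comm_ring_1 mpoly" where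
  "sqfree_mono F = (\<Prod>j\<in>F. var j)"

definition sqfree_monomials :: "nat \<Rightarrow> 'k::comm_ring_1 mpoly set" where
  "sqfree_monomials n = {sqfree_mono F | F. F \<subseteq> {1..n}}"

definition sqfree_monomials_of_degree :: "nat \<Rightarrow> nat \<Rightarrow> 'k::comm_ring_1 mpoly set" where
  "sqfree_monomials_of_degree n d = {sqfree_mono F | F. F \<subseteq> {1..n} \<and> card F = d}"

definition sqfree_monomial_ideal :: "nat \<Rightarrow> 'k::comm_ring_1 mpoly set \<Rightarrow> bool" where
  "sqfree_monomial_ideal n I \<longleftrightarrow> (\<exists>G \<subseteq> sqfree_monomials n. I = genideal (mpoly_ring n) G)"

definition minimal_monomial_generating_set ::
    "nat \<Rightarrow> 'k::comm_ring_1 mpoly set \<Rightarrow> 'k mpoly set \<Rightarrow> bool" where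
  "minimal_monomial_generating_set n I G \<longleftrightarrow>
     G \<subseteq> monomials n \<and> genideal (mpoly_ring n) G = I \<and>
     (\<forall>H. H \<subset> G \<longrightarrow> genideal (mpoly_ring n) H \<noteq> I)"

text \<open>Every monomial ideal has exactly one minimal generating set of monomials, which justifies
  the definite description; on other ideals the value is meaningless.\<close>

definition minimal_generators :: "nat \<Rightarrow> 'k::comm_ring_1 mpoly set \<Rightarrow> 'k mpoly set" where
  "minimal_generators n I = (THE G. minimal_monomial_generating_set n I G)"

definition stanley_reisner_complex :: "nat \<Rightarrow> 'k::comm_ring_1 mpoly set \<Rightarrow> nat set set" where
  "stanley_reisner_complex n I = {F. F \<subseteq> {1..n} \<and> sqfree_mono F \<notin> I}"

definition facet_complex :: "nat \<Rightarrow> 'k::comm_ring_1 mpoly set \<Rightarrow> nat set set" where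
  "facet_complex n I =
     {F. F \<subseteq> {1..n} \<and>
         (\<exists>g \<in> minimal_generators n I. sqfree_mono F divides\<^bsub>mpoly_ring n\<^esub> g)}"

text \<open>
  Entry \<open>k\<close> (counted from 0) of the list is \<open>f\<^sub>k\<^sub>-\<^sub>1\<close>, the number of faces with \<open>k\<close> elements. For a
  complex of dimension \<open>e\<close> the list ends at \<open>k = e + 1\<close>, the largest size of a face, so complexes
  with equal f-vectors have equal dimension. The complex without faces has the empty f-vector.
\<close>

definition f_vector :: "'a set set \<Rightarrow> nat list" where
  "f_vector K =
     (if K = {} then []
      else map (\<lambda>k. card {F \<in> K. card F = k}) [0..<Suc (Max (card ` K))])"

text \<open>The ideals considered are the squarefree monomial ideals whose minimal monomial generators
  all have degree at least 2; this is part of being an f-ideal.\<close>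

definition f_ideal :: "nat \<Rightarrow> 'k::comm_ring_1 mpoly set \<Rightarrow> bool" where
  "f_ideal n I \<longleftrightarrow>
     sqfree_monomial_ideal n I \<and>
     (\<forall>m. mono_of m \<in> minimal_generators n I \<longrightarrow> 2 \<le> mono_degree m) \<and>
     f_vector (stanley_reisner_complex n I) = f_vector (facet_complex n I)"

end

theory Submission
  imports Defs
begin

text \<open>
  Only the sets of variables matter. If \<open>T\<close> is the family of 3-subsets of \<open>V = {1..n}\<close> whose
  monomials generate \<open>I\<close>, then a monomial lies in \<open>I\<close> exactly when some generator divides it
  (lemma \<open>mono_of_in_genideal_iff\<close>), and distinct generators of equal degree do not divide one
  another, so they are the minimal ones (lemma \<open>minimal_generators_antichain\<close>). Hence the Stanley-Reisner
  complex consists of the subsets of \<open>V\<close> that contain no member of \<open>T\<close>, and the facet complex of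
  those that are contained in a member.

  Comparing face numbers size by size, for a family of \<open>d\<close>-sets, gives lemma
  \<open>f_vector_eq_of_perfect\<close>. Below size \<open>d\<close> the Stanley-Reisner complex has all faces, so \<open>T\<close> must
  cover every \<open>(d - 1)\<close>-set. Above size \<open>d\<close> the facet complex has no faces, so every
  \<open>(d + 1)\<close>-set must contain a member of \<open>T\<close>. In size \<open>d\<close> the faces are the complement of \<open>T\<close> and
  \<open>T\<close> itself, so \<open>T\<close> must have half of all \<open>d\<close>-sets.

  For \<open>d = 3\<close> the size of \<open>G3\<close> settles the last condition, as \<open>G1\<close> and \<open>G2\<close> are disjoint, and
  the residue classes modulo 3 in their cyclic order settle the others (lemmas
  \<open>four_set_contains_triple\<close> and \<open>pair_extends_to_triple\<close>). Among four points two lie in a common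
  class; if no further point is in that class or in the next one, both lie in the class after
  that, and these two together with a point of the first class form a triple of \<open>G2\<close>, because the
  cycle has length three. As for pairs, any two distinct classes are cyclically adjacent, and two
  points in equal or adjacent classes extend by a third point of a suitable class.
\<close>

section \<open>Ideals generated by monomials\<close>

lemma cring_mpoly_ring: "cring (mpoly_ring n :: 'k::comm_ring_1 mpoly ring)"
proof (rule cringI)
  show "abelian_group (mpoly_ring n :: 'k mpoly ring)"
  proof (rule abelian_groupI)
    fix x y :: "'k mpoly" assume "x \<in> carrier (mpoly_ring n :: 'k mpoly ring)" "y \<in> carrier (mpoly_ring n)"
    then show "x \<oplus>\<^bsub>mpoly_ring n\<^esub> y \<in> carrier (mpoly_ring n :: 'k mpoly ring)"
      using Poly_Mapping.keys_add[of x y] by (auto simp: mpoly_ring_def)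
  next
    fix x assume "x \<in> carrier (mpoly_ring n :: 'k mpoly ring)"
    then show "\<exists>y\<in>carrier (mpoly_ring n). y \<oplus>\<^bsub>mpoly_ring n\<^esub> x = \<zero>\<^bsub>mpoly_ring n\<^esub>"
      by (intro bexI[of _ "- x"]) (auto simp: mpoly_ring_def)
  qed (auto simp: mpoly_ring_def algebra_simps)
next
  show "Group.comm_monoid (mpoly_ring n :: 'k mpoly ring)"
  proof (rule comm_monoidI)
    fix x y :: "'k mpoly" assume "x \<in> carrier (mpoly_ring n :: 'k mpoly ring)" "y \<in> carrier (mpoly_ring n)"
    then have x: "\<And>a. a \<in> Poly_Mapping.keys x \<Longrightarrow> Poly_Mapping.keys a \<subseteq> {1..n}" and y: "\<And>b. b \<in> Poly_Mapping.keys y \<Longrightarrow> Poly_Mapping.keys b \<subseteq> {1..n}"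
      by (auto simp: mpoly_ring_def)
    have "Poly_Mapping.keys m \<subseteq> {1..n}" if m: "m \<in> Poly_Mapping.keys (x * y)" for m
    proof -
      obtain a b where "a \<in> Poly_Mapping.keys x" "b \<in> Poly_Mapping.keys y" "m = a + b"
        using m Poly_Mapping.keys_mult[of x y] by blast
      then show ?thesis using x y Poly_Mapping.keys_add[of a b] by blast
    qed
    then show "x \<otimes>\<^bsub>mpoly_ring n\<^esub> y \<in> carrier (mpoly_ring n :: 'k mpoly ring)"
      by (simp add: mpoly_ring_def)
  qed (auto simp: mpoly_ring_def algebra_simps)
qed (auto simp: mpoly_ring_def algebra_simps)

lemma mono_of_in_carrier: "Poly_Mapping.keys m \<subseteq> {1..n} \<Longrightarrow> mono_of m \<in> carrier (mpoly_ring n)"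
  by (auto simp: mpoly_ring_def mono_of_def)

lemma mono_of_mult: "mono_of (a + b) = mono_of a * mono_of b"
  by (simp add: mono_of_def Poly_Mapping.mult_single)

lemma keys_mono_of [simp]: "Poly_Mapping.keys (mono_of m :: 'k::comm_ring_1 mpoly) = {m}"
  by (simp add: mono_of_def)

lemma inj_mono_of: "inj (mono_of :: _ \<Rightarrow> 'k::comm_ring_1 mpoly)"
  by (rule injI) (metis keys_mono_of singleton_inject)

text \<open>Exponents in \<open>nat\<close> do not cancel in a sum, so cofactors bring in no new variables.\<close>

lemma keys_summand_subset: "Poly_Mapping.keys (c :: nat \<Rightarrow>\<^sub>0 nat) \<subseteq> Poly_Mapping.keys (a + c)"
  by (auto simp: in_keys_iff lookup_add)

lemma mono_of_divides_iff:
  assumes "Poly_Mapping.keys b \<subseteq> {1..n}"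
  shows "mono_of a divides\<^bsub>mpoly_ring n\<^esub> (mono_of b :: 'k::comm_ring_1 mpoly) \<longleftrightarrow> (\<exists>c. b = a + c)"
proof
  assume "mono_of a divides\<^bsub>mpoly_ring n\<^esub> (mono_of b :: 'k mpoly)"
  then obtain q :: "'k mpoly" where "mono_of b = mono_of a * q"
    by (auto simp: factor_def mpoly_ring_def)
  then have "b \<in> Poly_Mapping.keys (mono_of a * q)"
    by (metis keys_mono_of singletonI)
  then show "\<exists>c. b = a + c"
    using Poly_Mapping.keys_mult[of "mono_of a" q] by auto
next
  assume "\<exists>c. b = a + c"
  then obtain c where c: "b = a + c" ..
  then have "Poly_Mapping.keys c \<subseteq> {1..n}"
    using assms keys_summand_subset[of c a] by blast
  then show "mono_of a divides\<^bsub>mpoly_ring n\<^esub> (mono_of b :: 'k mpoly)"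
    unfolding factor_def
    using c mono_of_in_carrier[of c n]
    by (intro bexI[of _ "mono_of c"]) (auto simp: mono_of_mult mpoly_ring_def)
qed

text \<open>The polynomials each of whose terms is divisible by some monomial of the set form an ideal,
  since divisibility survives multiplication by a further monomial. This ideal bounds the
  generated one from above.\<close>

lemma mono_of_in_genideal_iff:
  assumes A: "\<And>a. a \<in> A \<Longrightarrow> Poly_Mapping.keys a \<subseteq> {1..n}" and m: "Poly_Mapping.keys m \<subseteq> {1..n}"
  shows "(mono_of m :: 'k::comm_ring_1 mpoly) \<in> genideal (mpoly_ring n) (mono_of ` A)
           \<longleftrightarrow> (\<exists>a\<in>A. \<exists>c. m = a + c)"
proof -
  let ?R = "mpoly_ring n :: 'k mpoly ring"
  interpret cring ?R by (rule cring_mpoly_ring)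
  have gens: "mono_of ` A \<subseteq> carrier ?R"
    using A mono_of_in_carrier by blast
  define J :: "'k mpoly set" where
    "J = {p \<in> carrier ?R. \<forall>k\<in>Poly_Mapping.keys p. \<exists>a\<in>A. \<exists>c. k = a + c}"
  have prod_J: "x * p \<in> J" if "p \<in> J" "x \<in> carrier ?R" for p x
  proof -
    have "x * p \<in> carrier ?R"
      using m_closed[of x p] that by (simp add: J_def mpoly_ring_def)
    moreover have "\<exists>a\<in>A. \<exists>c. k = a + c" if k: "k \<in> Poly_Mapping.keys (x * p)" for k
    proof -
      obtain s t where "t \<in> Poly_Mapping.keys p" "k = s + t"
        using k Poly_Mapping.keys_mult[of x p] by blast
      moreover then obtain a c where "a \<in> A" "t = a + c"
        using \<open>p \<in> J\<close> by (auto simp: J_def)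
      ultimately have "k = a + (s + c)"
        by (simp add: ac_simps)
      with \<open>a \<in> A\<close> show ?thesis by blast
    qed
    ultimately show ?thesis by (auto simp: J_def)
  qed
  have "ideal J ?R"
  proof (rule idealI)
    show "ring ?R" by (rule ring_axioms)
    show "subgroup J (add_monoid ?R)"
    proof (rule subgroup.intro)
      show "J \<subseteq> carrier (add_monoid ?R)" by (auto simp: J_def)
      show "\<one>\<^bsub>add_monoid ?R\<^esub> \<in> J" by (auto simp: J_def mpoly_ring_def)
      show "x \<otimes>\<^bsub>add_monoid ?R\<^esub> y \<in> J" if "x \<in> J" "y \<in> J" for x y
        using that Poly_Mapping.keys_add[of x y] by (fastforce simp: J_def mpoly_ring_def)
      show "inv\<^bsub>add_monoid ?R\<^esub> x \<in> J" if "x \<in> J" for x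
      proof -
        have "\<ominus>\<^bsub>?R\<^esub> x = - x"
          using that by (intro minus_equality) (auto simp: J_def mpoly_ring_def)
        then show ?thesis
          using that by (auto simp: a_inv_def J_def mpoly_ring_def)
      qed
    qed
    show "x \<otimes>\<^bsub>?R\<^esub> a \<in> J" if "a \<in> J" "x \<in> carrier ?R" for a x
      using prod_J[OF that] by (simp add: mpoly_ring_def)
    show "a \<otimes>\<^bsub>?R\<^esub> x \<in> J" if "a \<in> J" "x \<in> carrier ?R" for a x
      using prod_J[OF that] by (simp add: mpoly_ring_def mult.commute)
  qed
  moreover have "mono_of ` A \<subseteq> J"
    using gens by (auto simp: J_def intro!: exI[of _ 0])
  ultimately have "genideal ?R (mono_of ` A) \<subseteq> J"
    by (rule genideal_minimal)
  moreover have "mono_of m \<in> genideal ?R (mono_of ` A)" if "a \<in> A" "m = a + c" for a c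
  proof -
    have "Poly_Mapping.keys c \<subseteq> {1..n}"
      using m that(2) keys_summand_subset[of c a] by blast
    then have "mono_of a \<otimes>\<^bsub>?R\<^esub> mono_of c \<in> genideal ?R (mono_of ` A)"
      using genideal_ideal[OF gens] genideal_self[OF gens] that(1) mono_of_in_carrier
      by (intro ideal.I_r_closed) auto
    then show ?thesis
      using that(2) by (simp add: mono_of_mult mpoly_ring_def)
  qed
  ultimately show ?thesis by (auto simp: J_def)
qed

text \<open>A monomial \<open>a\<close> of the antichain is divisible by a member \<open>b\<close> of any other monomial
  generating set, and \<open>b\<close> in turn by a member of the antichain, which can only be \<open>a\<close>. So every
  monomial generating set contains the antichain, and the antichain itself generates the ideal.\<close>

lemma minimal_generators_antichain:
  assumes A: "\<And>a. a \<in> A \<Longrightarrow> Poly_Mapping.keys a \<subseteq> {1..n}"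
    and antichain: "\<And>a b c. a \<in> A \<Longrightarrow> b \<in> A \<Longrightarrow> b = a + c \<Longrightarrow> a = b"
  shows "minimal_generators n (genideal (mpoly_ring n) (mono_of ` A))
           = (mono_of ` A :: 'k::comm_ring_1 mpoly set)"
proof -
  let ?I = "genideal (mpoly_ring n) (mono_of ` A) :: 'k mpoly set"
  have contains: "mono_of ` A \<subseteq> H"
    if H: "H \<subseteq> monomials n" "genideal (mpoly_ring n) H = ?I" for H :: "'k mpoly set"
  proof
    fix g :: "'k mpoly" assume "g \<in> mono_of ` A"
    then obtain a where a: "a \<in> A" "g = mono_of a" by blast
    obtain B where B: "H = mono_of ` B" "\<And>b. b \<in> B \<Longrightarrow> Poly_Mapping.keys b \<subseteq> {1..n}"
    proof
      show "H = mono_of ` {m. Poly_Mapping.keys m \<subseteq> {1..n} \<and> mono_of m \<in> H}"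
        using H(1) by (auto simp: monomials_def)
    qed auto
    have in_I_iff_A: "mono_of m \<in> ?I \<longleftrightarrow> (\<exists>a\<in>A. \<exists>c. m = a + c)" if "Poly_Mapping.keys m \<subseteq> {1..n}" for m
      using mono_of_in_genideal_iff[OF A that] by simp
    have in_I_iff_B: "mono_of m \<in> ?I \<longleftrightarrow> (\<exists>b\<in>B. \<exists>c. m = b + c)" if "Poly_Mapping.keys m \<subseteq> {1..n}" for m
      using mono_of_in_genideal_iff[of B n m, where ?'k = 'k] B(2) that H(2) unfolding B(1) by simp
    have "mono_of a \<in> ?I"
      using in_I_iff_A[OF A[OF a(1)]] a(1) by (auto intro!: bexI[of _ a] exI[of _ 0])
    then obtain b c where b: "b \<in> B" "a = b + c"
      using in_I_iff_B[OF A[OF a(1)]] by blast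
    have "mono_of b \<in> ?I"
      using in_I_iff_B[OF B(2)[OF b(1)]] b(1) by (auto intro!: bexI[of _ b] exI[of _ 0])
    then obtain a' c' where a': "a' \<in> A" "b = a' + c'"
      using in_I_iff_A[OF B(2)[OF b(1)]] by blast
    have a_eq: "a = a' + (c' + c)"
      by (simp only: b(2) a'(2) add.assoc)
    then have "a' = a"
      using antichain[OF a'(1) a(1)] by blast
    with a_eq have "c' + c = 0"
      by simp
    then have "c' = 0"
      using keys_summand_subset[of c' c] by (simp add: add.commute)
    with a'(2) \<open>a' = a\<close> have "b = a"
      by simp
    then show "g \<in> H"
      using a(2) b(1) B(1) by blast
  qed
  have "minimal_monomial_generating_set n ?I (mono_of ` A)"
    unfolding minimal_monomial_generating_set_def
  proof (intro conjI allI impI)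
    show mono: "mono_of ` A \<subseteq> (monomials n :: 'k mpoly set)"
      using A by (auto simp: monomials_def)
    show "genideal (mpoly_ring n) H \<noteq> ?I" if "H \<subset> mono_of ` A" for H
      using contains[of H] that mono by blast
  qed simp
  then show ?thesis
    unfolding minimal_generators_def
  proof (rule the_equality)
    fix H :: "'k mpoly set" assume "minimal_monomial_generating_set n ?I H"
    then show "H = mono_of ` A"
      using contains[of H] unfolding minimal_monomial_generating_set_def by blast
  qed
qed

section \<open>Squarefree monomials\<close>

definition indicator_exponent :: "nat set \<Rightarrow> nat \<Rightarrow>\<^sub>0 nat" where
  "indicator_exponent F = (\<Sum>j\<in>F. Poly_Mapping.single j 1)"

lemma sqfree_mono_eq_mono_of: "sqfree_mono F = mono_of (indicator_exponent F)"
  unfolding indicator_exponent_def sqfree_mono_def var_def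
  by (induction F rule: infinite_finite_induct) (simp_all add: mono_of_mult, simp_all add: mono_of_def)

lemma lookup_indicator_exponent:
  "finite F \<Longrightarrow> Poly_Mapping.lookup (indicator_exponent F) j = (if j \<in> F then 1 else 0)"
  unfolding indicator_exponent_def by (simp add: lookup_sum lookup_single when_def)

lemma keys_indicator_exponent: "finite F \<Longrightarrow> Poly_Mapping.keys (indicator_exponent F) = F"
  by (auto simp: in_keys_iff lookup_indicator_exponent split: if_splits)

lemma inj_on_sqfree_mono:
  "inj_on (sqfree_mono :: _ \<Rightarrow> 'k::comm_ring_1 mpoly) {F. finite F}"
proof (rule inj_onI)
  fix F F' assume fin: "F \<in> {F. finite F}" "F' \<in> {F. finite F}"
    and "(sqfree_mono F :: 'k mpoly) = sqfree_mono F'"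
  then have "indicator_exponent F = indicator_exponent F'"
    by (simp add: sqfree_mono_eq_mono_of inj_eq[OF inj_mono_of])
  then show "F = F'"
    using fin keys_indicator_exponent by (metis mem_Collect_eq)
qed

lemma mono_degree_indicator_exponent:
  "finite F \<Longrightarrow> mono_degree (indicator_exponent F) = card F"
  by (simp add: mono_degree_def keys_indicator_exponent lookup_indicator_exponent)

lemma indicator_exponent_divides_iff:
  assumes "finite A" "finite B"
  shows "(\<exists>c. indicator_exponent B = indicator_exponent A + c) \<longleftrightarrow> A \<subseteq> B"
proof
  assume "\<exists>c. indicator_exponent B = indicator_exponent A + c"
  then show "A \<subseteq> B"
    using keys_summand_subset[of "indicator_exponent A"] assms
    by (metis add.commute keys_indicator_exponent)
next
  assume "A \<subseteq> B"
  then have "indicator_exponent B = indicator_exponent A + indicator_exponent (B - A)"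
    using assms by (auto intro!: poly_mapping_eqI simp: lookup_add lookup_indicator_exponent
        finite_subset)
  then show "\<exists>c. indicator_exponent B = indicator_exponent A + c" ..
qed

lemma sqfree_mono_triple:
  "u \<noteq> v \<Longrightarrow> u \<noteq> w \<Longrightarrow> v \<noteq> w \<Longrightarrow> sqfree_mono {u, v, w} = var u * var v * var w"
  by (simp add: sqfree_mono_def mult.assoc)

lemma inj_var: "inj (var :: nat \<Rightarrow> 'k::comm_ring_1 mpoly)"
proof (rule injI)
  fix i j assume "(var i :: 'k mpoly) = var j"
  then have "(sqfree_mono {i} :: 'k mpoly) = sqfree_mono {j}"
    by (simp add: sqfree_mono_def)
  then show "i = j"
    using inj_on_sqfree_mono by (auto dest!: inj_onD)
qed

section \<open>Ideals generated by squarefree monomials of one degree\<close>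

text \<open>The length of an f-vector needs no separate hypothesis: the sizes of faces that occur are
  those with a nonzero count.\<close>

lemma f_vector_cong:
  fixes K L :: "'a set set"
  assumes fin: "finite K" "finite L"
    and counts: "\<And>k. card {F \<in> K. card F = k} = card {F \<in> L. card F = k}"
  shows "f_vector K = f_vector L"
proof -
  have support: "card ` M = {k. card {F \<in> M. card F = k} \<noteq> 0}" if "finite M" for M :: "'a set set"
    using that by (auto simp: card_eq_0_iff)
  have sizes: "card ` K = card ` L"
    unfolding support[OF fin(1)] support[OF fin(2)] counts ..
  then have "K = {} \<longleftrightarrow> L = {}" by blast
  then show ?thesis
    by (simp add: f_vector_def sizes counts)
qed

text \<open>The hypotheses \<open>upper\<close> and \<open>lower\<close> speak of one size only. They propagate, since larger
  sets contain \<open>(d + 1)\<close>-sets and smaller sets can be enlarged to \<open>(d - 1)\<close>-sets.\<close>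

lemma f_vector_eq_of_perfect:
  fixes V :: "'a set"
  assumes "finite V" "T \<subseteq> {F. F \<subseteq> V \<and> card F = d}" "T \<noteq> {}"
    and half: "2 * card T = card V choose d"
    and upper: "\<And>F. F \<subseteq> V \<Longrightarrow> card F = Suc d \<Longrightarrow> \<exists>t\<in>T. t \<subseteq> F"
    and lower: "\<And>F. F \<subseteq> V \<Longrightarrow> Suc (card F) = d \<Longrightarrow> \<exists>t\<in>T. F \<subseteq> t"
  shows "f_vector {F. F \<subseteq> V \<and> \<not> (\<exists>t\<in>T. t \<subseteq> F)} = f_vector {F. F \<subseteq> V \<and> (\<exists>t\<in>T. F \<subseteq> t)}"
    (is "f_vector ?K = f_vector ?L")
proof (rule f_vector_cong)
  show "finite ?K" "finite ?L"
    using \<open>finite V\<close> by simp_all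
  fix k
  have T: "t \<subseteq> V" "finite t" "card t = d" if "t \<in> T" for t
    using that assms(2) finite_subset[OF _ assms(1), of t] by auto
  have finF: "finite F" if "F \<subseteq> V" for F
    using that \<open>finite V\<close> by (rule finite_subset)
  consider "k < d" | "k = d" | "k > d" by linarith
  then show "card {F \<in> ?K. card F = k} = card {F \<in> ?L. card F = k}"
  proof cases
    case 1
    have K: "\<not> (\<exists>t\<in>T. t \<subseteq> F)" if "F \<subseteq> V" "card F = k" for F
    proof (rule notI, elim bexE)
      fix t assume "t \<in> T" "t \<subseteq> F"
      then show False
        using card_mono[OF finF[OF that(1)], of t] that(2) 1 T(3)[of t] by simp
    qed
    have L: "\<exists>t\<in>T. F \<subseteq> t" if F: "F \<subseteq> V" "card F = k" for F
    proof -
      obtain t where "t \<in> T"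
        using \<open>T \<noteq> {}\<close> by blast
      then have "d \<le> card V"
        using T card_mono[OF \<open>finite V\<close>, of t] by simp
      then have "card F \<le> d - 1" "d - 1 \<le> card V"
        using F(2) 1 by simp_all
      then obtain E where E: "F \<subseteq> E" "E \<subseteq> V" "card E = d - 1"
        using exists_subset_between[OF _ _ F(1) \<open>finite V\<close>] by blast
      then have "Suc (card E) = d"
        using 1 by simp
      then obtain t' where "t' \<in> T" "E \<subseteq> t'"
        using lower[OF E(2)] by blast
      then show ?thesis
        using E(1) by blast
    qed
    have "F \<in> ?K \<longleftrightarrow> F \<in> ?L" if "card F = k" for F
      using K[OF _ that] L[OF _ that] by (cases "F \<subseteq> V") simp_all
    then have "F \<in> ?K \<and> card F = k \<longleftrightarrow> F \<in> ?L \<and> card F = k" for F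
      by (simp only: conj_commute[of _ "card F = k"] cong: conj_cong)
    then show ?thesis by (simp only:)
  next
    case 2
    have eq: "t = F" if "t \<in> T" "F \<subseteq> V" "card F = d" "t \<subseteq> F \<or> F \<subseteq> t" for t F
      using that(4)
    proof
      assume "t \<subseteq> F"
      then show "t = F"
        using card_subset_eq[OF finF[OF that(2)]] T(3)[OF that(1)] that(3) by simp
    next
      assume "F \<subseteq> t"
      then show "t = F"
        using card_subset_eq[OF T(2)[OF that(1)], of F] T(3)[OF that(1)] that(3) by simp
    qed
    have K: "{F \<in> ?K. card F = k} = {F. F \<subseteq> V \<and> card F = d} - T"
    proof (intro equalityI subsetI)
      fix F assume "F \<in> {F. F \<subseteq> V \<and> card F = d} - T"
      moreover then have "\<not> (\<exists>t\<in>T. t \<subseteq> F)"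
        using eq[of _ F] by auto
      ultimately show "F \<in> {F \<in> ?K. card F = k}"
        using 2 by simp
    qed (use 2 in auto)
    have "card {F \<in> ?K. card F = k} = (card V choose d) - card T"
      unfolding K using assms(1,2) by (simp add: card_Diff_subset finite_subset n_subsets)
    moreover have "{F \<in> ?L. card F = k} = T"
    proof (intro equalityI subsetI)
      fix F assume "F \<in> {F \<in> ?L. card F = k}"
      then obtain t where "t \<in> T" "F \<subseteq> t" "F \<subseteq> V" "card F = d"
        using 2 by blast
      then show "F \<in> T"
        using eq[of t F] by simp
    next
      fix F assume "F \<in> T"
      then show "F \<in> {F \<in> ?L. card F = k}"
        using T(1,3)[of F] 2 by blast
    qed
    ultimately show ?thesis
      using half by simp
  next
    case 3
    have K: "\<exists>t\<in>T. t \<subseteq> F" if F: "F \<subseteq> V" "card F = k" for F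
    proof -
      have "Suc d \<le> card F"
        using 3 F(2) by simp
      then obtain E where E: "E \<subseteq> F" "card E = Suc d"
        by (rule obtain_subset_with_card_n)
      then show ?thesis
        using upper[of E] F(1) by blast
    qed
    have L: "\<not> (\<exists>t\<in>T. F \<subseteq> t)" if "F \<subseteq> V" "card F = k" for F
    proof (rule notI, elim bexE)
      fix t assume "t \<in> T" "F \<subseteq> t"
      then show False
        using card_mono[OF T(2), of t F] that(2) 3 T(3)[of t] by simp
    qed
    have "F \<notin> ?K" "F \<notin> ?L" if "card F = k" for F
      using K[OF _ that] L[OF _ that] by simp_all
    then have "{F \<in> ?K. card F = k} = {}" "{F \<in> ?L. card F = k} = {}"
      by (simp_all only: Collect_empty_eq) metis+
    then show ?thesis by (simp only:)
  qed
qed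

lemma f_ideal_of_perfect:
  fixes T :: "nat set set"
  assumes T: "T \<subseteq> {F. F \<subseteq> {1..n} \<and> card F = d}" and "T \<noteq> {}" "2 \<le> d"
    and half: "2 * card T = n choose d"
    and upper: "\<And>F. F \<subseteq> {1..n} \<Longrightarrow> card F = Suc d \<Longrightarrow> \<exists>t\<in>T. t \<subseteq> F"
    and lower: "\<And>F. F \<subseteq> {1..n} \<Longrightarrow> Suc (card F) = d \<Longrightarrow> \<exists>t\<in>T. F \<subseteq> t"
  shows "f_ideal n (genideal (mpoly_ring n) (sqfree_mono ` T :: 'k::comm_ring_1 mpoly set))"
proof -
  let ?G = "sqfree_mono ` T :: 'k mpoly set"
  let ?I = "genideal (mpoly_ring n) ?G"
  let ?A = "indicator_exponent ` T"
  have G: "?G = mono_of ` ?A"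
    by (auto simp: sqfree_mono_eq_mono_of)
  have fin: "finite F" if "F \<subseteq> {1..n}" for F
    using that by (rule finite_subset) simp
  have finT: "finite t" "t \<subseteq> {1..n}" "card t = d" if "t \<in> T" for t
    using that T fin by auto
  have A: "Poly_Mapping.keys a \<subseteq> {1..n}" if "a \<in> ?A" for a
    using that finT keys_indicator_exponent by blast
  have min_gens: "minimal_generators n ?I = ?G"
    unfolding G
  proof (rule minimal_generators_antichain[OF A])
    fix a b c assume "a \<in> ?A" "b \<in> ?A" "b = a + c"
    then obtain s t where st: "s \<in> T" "t \<in> T" "a = indicator_exponent s" "b = indicator_exponent t"
      by blast
    then have "s \<subseteq> t"
      using \<open>b = a + c\<close> indicator_exponent_divides_iff finT by metis
    then show "a = b"
      using st finT card_subset_eq by metis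
  qed
  have "sqfree_mono F \<in> ?I \<longleftrightarrow> (\<exists>t\<in>T. t \<subseteq> F)" if F: "F \<subseteq> {1..n}" for F
  proof -
    have "sqfree_mono F \<in> ?I \<longleftrightarrow> (\<exists>a\<in>?A. \<exists>c. indicator_exponent F = a + c)"
      unfolding G sqfree_mono_eq_mono_of[of F]
      by (rule mono_of_in_genideal_iff[OF A]) (use F fin keys_indicator_exponent in auto)
    then show ?thesis
      using indicator_exponent_divides_iff[OF finT(1) fin[OF F]] by simp
  qed
  then have SR: "stanley_reisner_complex n ?I = {F. F \<subseteq> {1..n} \<and> \<not> (\<exists>t\<in>T. t \<subseteq> F)}"
    by (auto simp: stanley_reisner_complex_def)
  have divides: "sqfree_mono F divides\<^bsub>mpoly_ring n\<^esub> (sqfree_mono t :: 'k mpoly) \<longleftrightarrow> F \<subseteq> t"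
    if "F \<subseteq> {1..n}" "t \<in> T" for F t
    unfolding sqfree_mono_eq_mono_of
    using mono_of_divides_iff[of "indicator_exponent t" n "indicator_exponent F", where ?'k = 'k]
      finT(1,2)[OF that(2)] fin[OF that(1)]
    by (simp add: keys_indicator_exponent indicator_exponent_divides_iff)
  have FC: "facet_complex n ?I = {F. F \<subseteq> {1..n} \<and> (\<exists>t\<in>T. F \<subseteq> t)}"
    unfolding facet_complex_def min_gens
    by (intro Collect_cong conj_cong refl) (simp add: divides)
  show ?thesis
    unfolding f_ideal_def
  proof (intro conjI allI impI)
    have "?G \<subseteq> sqfree_monomials n"
      using finT by (auto simp: sqfree_monomials_def)
    then show "sqfree_monomial_ideal n ?I"
      by (auto simp: sqfree_monomial_ideal_def)
    show "2 \<le> mono_degree m" if m: "mono_of m \<in> minimal_generators n ?I" for m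
    proof -
      obtain t where "t \<in> T" "m = indicator_exponent t"
        using m unfolding min_gens by (auto simp: sqfree_mono_eq_mono_of inj_eq[OF inj_mono_of])
      then show ?thesis
        using mono_degree_indicator_exponent finT \<open>2 \<le> d\<close> by simp
    qed
    show "f_vector (stanley_reisner_complex n ?I) = f_vector (facet_complex n ?I)"
      unfolding SR FC
      by (rule f_vector_eq_of_perfect[where d = d]) (use assms in auto)
  qed
qed

section \<open>Triples in residue classes modulo 3\<close>

definition monochromatic_triples :: "nat \<Rightarrow> nat set set" where
  "monochromatic_triples n = {{u, v, w} | u v w. {u, v, w} \<subseteq> {1..n} \<and> u \<noteq> v \<and> u \<noteq> w \<and> v \<noteq> w \<and>
     v mod 3 = u mod 3 \<and> w mod 3 = u mod 3}"

definition cyclic_triples :: "nat \<Rightarrow> nat set set" where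
  "cyclic_triples n = {{u, v, w} | u v w. {u, v, w} \<subseteq> {1..n} \<and> u \<noteq> v \<and> u \<noteq> w \<and> v \<noteq> w \<and>
     v mod 3 = u mod 3 \<and> w mod 3 = (u + 1) mod 3}"

lemma next_residue_neq: "(x + 1) mod 3 \<noteq> x mod (3::nat)"
  by (simp add: mod_Suc)

lemma next_residue_inj: "(x + 1) mod 3 = (y + 1) mod 3 \<Longrightarrow> x mod 3 = y mod (3::nat)"
  by (simp add: mod_Suc split: if_splits)

lemma residues_equal_or_adjacent:
  obtains "y mod 3 = x mod (3::nat)" | "y mod 3 = (x + 1) mod 3" | "x mod 3 = (y + 1) mod 3"
proof -
  have "x mod 3 < 3" "y mod 3 < 3"
    by simp_all
  then have "y mod 3 = x mod 3 \<or> y mod 3 = (x + 1) mod 3 \<or> x mod 3 = (y + 1) mod 3"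
    by (auto simp: mod_Suc simp del: mod_less_divisor)
  then show thesis
    using that by blast
qed

lemma monochromatic_triplesI:
  assumes "{u, v, w} \<subseteq> {1..n}" "u \<noteq> v" "u \<noteq> w" "v \<noteq> w" "v mod 3 = u mod 3" "w mod 3 = u mod 3"
  shows "{u, v, w} \<in> monochromatic_triples n"
  using assms unfolding monochromatic_triples_def by blast

lemma cyclic_triplesI:
  assumes "{u, v, w} \<subseteq> {1..n}" "u \<noteq> v" "v mod 3 = u mod 3" "w mod 3 = (u + 1) mod 3"
  shows "{u, v, w} \<in> cyclic_triples n"
proof -
  have "w mod 3 \<noteq> u mod 3"
    unfolding assms(4) by (rule next_residue_neq)
  then have "u \<noteq> w" "v \<noteq> w"
    using assms(3) by auto
  then show ?thesis
    using assms unfolding cyclic_triples_def by blast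
qed

lemma triples_disjoint: "monochromatic_triples n \<inter> cyclic_triples n = {}"
proof -
  have mono: "\<forall>x\<in>t. \<forall>y\<in>t. x mod 3 = y mod 3" if t: "t \<in> monochromatic_triples n" for t
  proof -
    obtain u v w where "t = {u, v, w}" "v mod 3 = u mod 3" "w mod 3 = u mod 3"
      using t unfolding monochromatic_triples_def by blast
    then show ?thesis by simp
  qed
  have "\<exists>x\<in>t. \<exists>y\<in>t. x mod 3 \<noteq> y mod 3" if t: "t \<in> cyclic_triples n" for t
  proof -
    obtain u v w where "t = {u, v, w}" "w mod 3 = (u + 1) mod 3"
      using t unfolding cyclic_triples_def by blast
    then have "u \<in> t" "w \<in> t" "w mod 3 \<noteq> u mod 3"
      using next_residue_neq by simp_all
    then show ?thesis by blast
  qed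
  with mono show ?thesis by blast
qed

lemma four_set_contains_triple:
  assumes F: "F \<subseteq> {1..n}" "card F = 4"
  shows "\<exists>t \<in> monochromatic_triples n \<union> cyclic_triples n. t \<subseteq> F"
proof -
  have "finite F"
    using F(2) card.infinite by fastforce
  have "card ((\<lambda>x. x mod 3) ` F) \<le> card {..<3::nat}"
    by (rule card_mono) auto
  then have "\<not> inj_on (\<lambda>x. x mod 3) F"
    using F(2) by (auto dest: card_image)
  then obtain a b where ab: "a \<in> F" "b \<in> F" "a \<noteq> b" "b mod 3 = a mod 3"
    by (auto simp: inj_on_def)
  have "card (F - {a, b}) = 2"
    using ab F(2) \<open>finite F\<close> by (simp add: card_Diff_subset)
  then obtain c d where cd: "F - {a, b} = {c, d}" "c \<noteq> d"
    by (auto simp: card_2_iff)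
  then have mem: "c \<in> F" "d \<in> F" "c \<noteq> a" "c \<noteq> b" "d \<noteq> a" "d \<noteq> b" by blast+
  have triple: "\<exists>t \<in> monochromatic_triples n \<union> cyclic_triples n. t \<subseteq> F"
    if "x \<in> F" "x \<noteq> a" "x \<noteq> b" "x mod 3 = a mod 3 \<or> x mod 3 = (a + 1) mod 3" for x
  proof (intro bexI)
    show "{a, b, x} \<subseteq> F"
      using ab(1,2) that(1) by simp
    then have "{a, b, x} \<subseteq> {1..n}"
      using F(1) by (rule subset_trans)
    with that(4) show "{a, b, x} \<in> monochromatic_triples n \<union> cyclic_triples n"
      using monochromatic_triplesI[of a b x n] cyclic_triplesI[of a b x n] ab(3,4) that(2,3) by auto
  qed
  \<comment> \<open>In the third case \<open>c\<close> and \<open>d\<close> both lie in the class before that of \<open>a\<close>.\<close>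
  consider "c mod 3 = a mod 3 \<or> c mod 3 = (a + 1) mod 3"
    | "d mod 3 = a mod 3 \<or> d mod 3 = (a + 1) mod 3"
    | "d mod 3 = c mod 3" "a mod 3 = (c + 1) mod 3"
    by (metis next_residue_inj residues_equal_or_adjacent)
  then show ?thesis
  proof cases
    case 3
    have "{c, d, a} \<subseteq> F"
      using mem(1,2) ab(1) by simp
    moreover from this have "{c, d, a} \<in> cyclic_triples n"
      using cyclic_triplesI[of c d a n] 3 cd(2) F(1) by (meson subset_trans)
    ultimately show ?thesis by blast
  qed (use triple[of c] triple[of d] mem in simp_all)
qed

text \<open>The bound \<open>n \<ge> 9\<close> gives every residue class at least three members, so that a class always
  has a member different from two given points.\<close>

lemma residue_class_avoiding_two:
  assumes "9 \<le> n"
  shows "\<exists>z\<in>{1..n}. z mod 3 = r mod 3 \<and> z \<noteq> x \<and> z \<noteq> (y::nat)"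
proof -
  \<comment> \<open>The least positive number of the class, so that \<open>z\<close>, \<open>z + 3\<close> and \<open>z + 6\<close> are at most 9.\<close>
  define z where "z = (if r mod 3 = 0 then 3 else r mod 3)"
  have z: "1 \<le> z" "z \<le> 3" "z mod 3 = r mod 3"
    using mod_less_divisor[of 3 r] by (auto simp: z_def simp del: mod_less_divisor)
  have "\<exists>q\<in>{0, 1, 2}. z + 3 * q \<noteq> x \<and> z + 3 * q \<noteq> y"
    by simp linarith
  then obtain q where q: "q \<in> {0, 1, 2}" "z + 3 * q \<noteq> x" "z + 3 * q \<noteq> y"
    by blast
  have "z + 3 * q \<in> {1..n}"
    using z(1,2) q(1) assms by auto
  moreover have "(z + 3 * q) mod 3 = r mod 3"
    using z(3) by simp
  ultimately show ?thesis
    using q(2,3) by blast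
qed

lemma pair_extends_to_triple:
  assumes "9 \<le> n" and F: "F \<subseteq> {1..n}" "card F = 2"
  shows "\<exists>t \<in> monochromatic_triples n \<union> cyclic_triples n. F \<subseteq> t"
proof -
  obtain a b where ab: "F = {a, b}" "a \<noteq> b"
    using F(2) by (auto simp: card_2_iff)
  have in_V: "a \<in> {1..n}" "b \<in> {1..n}"
    using F(1) ab(1) by simp_all
  have adjacent: "\<exists>t\<in>cyclic_triples n. {x, y} \<subseteq> t"
    if "x \<in> {1..n}" "y \<in> {1..n}" "y mod 3 = (x + 1) mod 3" for x y
  proof -
    obtain z where "z \<in> {1..n}" "z mod 3 = x mod 3" "z \<noteq> x"
      using residue_class_avoiding_two[OF \<open>9 \<le> n\<close>, of x x x] by blast
    then have "{x, z, y} \<in> cyclic_triples n"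
      using that by (intro cyclic_triplesI) simp_all
    then show ?thesis by blast
  qed
  show ?thesis
  proof (cases b a rule: residues_equal_or_adjacent)
    case 1
    obtain z where "z \<in> {1..n}" "z mod 3 = a mod 3" "z \<noteq> a" "z \<noteq> b"
      using residue_class_avoiding_two[OF \<open>9 \<le> n\<close>, of a a b] by blast
    then have "{a, b, z} \<in> monochromatic_triples n"
      using 1 ab(2) in_V by (intro monochromatic_triplesI) simp_all
    then show ?thesis
      unfolding ab(1) by (intro bexI[of _ "{a, b, z}"]) simp_all
  next
    case 2
    show ?thesis
      using adjacent[OF in_V 2] unfolding ab(1) bex_Un ..
  next
    case 3
    show ?thesis
      using adjacent[OF in_V(2,1) 3] unfolding ab(1) insert_commute[of a] bex_Un ..
  qed
qed

lemma triples_subset: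
  "monochromatic_triples n \<union> cyclic_triples n \<subseteq> {F. F \<subseteq> {1..n} \<and> card F = 3}"
  by (auto simp: monochromatic_triples_def cyclic_triples_def)

text \<open>This passes from products of variables to sets of indices: the shift \<open>e = 0\<close> gives the
  triples inside one residue class, and \<open>e = 1\<close> those with two points in a class and one in the
  next.\<close>

lemma products_eq_sqfree_monos:
  fixes S :: "nat \<Rightarrow> 'k::comm_ring_1 mpoly set"
  assumes S: "S = (\<lambda>i. {var j | j. 1 \<le> j \<and> j \<le> n \<and> j mod 3 = i mod 3})"
  shows "{a * b * c | a b c. a \<noteq> b \<and> a \<noteq> c \<and> b \<noteq> c \<and>
            (\<exists>i \<in> {1, 2, 3}. a \<in> S i \<and> b \<in> S i \<and> c \<in> S (i + e))}
         = sqfree_mono ` {{u, v, w} | u v w. {u, v, w} \<subseteq> {1..n} \<and> u \<noteq> v \<and> u \<noteq> w \<and> v \<noteq> w \<and>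
            v mod 3 = u mod 3 \<and> w mod 3 = (u + e) mod 3}"
    (is "?P = sqfree_mono ` ?T")
proof
  show "?P \<subseteq> sqfree_mono ` ?T"
  proof
    fix g assume "g \<in> ?P"
    then obtain a b c i where g: "g = a * b * c" "a \<noteq> b" "a \<noteq> c" "b \<noteq> c"
      "a \<in> S i" "b \<in> S i" "c \<in> S (i + e)"
      by blast
    then obtain u v w where uvw: "a = var u" "b = var v" "c = var w" "{u, v, w} \<subseteq> {1..n}"
      "u mod 3 = i mod 3" "v mod 3 = i mod 3" "w mod 3 = (i + e) mod 3"
      by (auto simp: S)
    have distinct: "u \<noteq> v" "u \<noteq> w" "v \<noteq> w"
      using g(2-4) uvw(1-3) by auto
    have "w mod 3 = (u + e) mod 3"
      using uvw(5,7) by (metis mod_add_left_eq)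
    moreover have "v mod 3 = u mod 3"
      using uvw(5,6) by simp
    ultimately have "{u, v, w} \<in> ?T"
      using uvw(4) distinct by blast
    moreover have "g = sqfree_mono {u, v, w}"
      using g(1) uvw(1-3) distinct by (simp add: sqfree_mono_triple)
    ultimately show "g \<in> sqfree_mono ` ?T" by blast
  qed
  show "sqfree_mono ` ?T \<subseteq> ?P"
  proof
    fix g :: "'k mpoly" assume "g \<in> sqfree_mono ` ?T"
    then obtain u v w where uvw: "g = sqfree_mono {u, v, w}" "{u, v, w} \<subseteq> {1..n}"
      "u \<noteq> v" "u \<noteq> w" "v \<noteq> w" "v mod 3 = u mod 3" "w mod 3 = (u + e) mod 3"
      by blast
    \<comment> \<open>The classes are numbered 1, 2, 3, so residue 0 belongs to the third one.\<close>
    define i where "i = (if u mod 3 = 0 then 3 else u mod 3)"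
    have i: "i \<in> {1, 2, 3}" "u mod 3 = i mod 3"
      unfolding i_def using mod_less_divisor[of 3 u] by (auto simp del: mod_less_divisor)
    have "w mod 3 = (i + e) mod 3"
      using uvw(7) i(2) by (metis mod_add_left_eq)
    then have "var u \<in> S i" "var v \<in> S i" "var w \<in> S (i + e)"
      using uvw(2,6) i(2) by (auto simp: S)
    moreover have "(var u :: 'k mpoly) \<noteq> var v" "(var u :: 'k mpoly) \<noteq> var w"
      "(var v :: 'k mpoly) \<noteq> var w"
      using uvw(3-5) inj_var by (auto dest: injD)
    moreover have "g = var u * var v * var w"
      using uvw(1,3-5) by (simp add: sqfree_mono_triple)
    ultimately show "g \<in> ?P"
      using i(1) by blast
  qed
qed

theorem theorem5p2:
  fixes n :: nat
    and S :: "nat \<Rightarrow> 'k::field mpoly set"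
    and G1 G2 G3 :: "'k mpoly set"
  assumes "n \<ge> 9"
    and "even (n choose 3)"
    and "S = (\<lambda>i. {var j | j. 1 \<le> j \<and> j \<le> n \<and> j mod 3 = i mod 3})"
    and "G1 = {a * b * c | a b c. a \<noteq> b \<and> a \<noteq> c \<and> b \<noteq> c \<and>
                 (\<exists>i \<in> {1, 2, 3}. a \<in> S i \<and> b \<in> S i \<and> c \<in> S i)}"
    and "G2 = {a * b * c | a b c. a \<noteq> b \<and> a \<noteq> c \<and> b \<noteq> c \<and>
                 (\<exists>i \<in> {1, 2, 3}. a \<in> S i \<and> b \<in> S i \<and> c \<in> S (i + 1))}"
    and "G3 \<subseteq> sqfree_monomials_of_degree n 3 - (G1 \<union> G2)"
    and "int (card G3) = int (n choose 3) div 2 - int (card G1) - int (card G2)"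
  shows "f_ideal n (genideal (mpoly_ring n) (G1 \<union> G2 \<union> G3))"
proof -
  let ?X = "sqfree_mono :: nat set \<Rightarrow> 'k mpoly"
  let ?all = "{F. F \<subseteq> {1..n} \<and> card F = 3}"
  define T1 where "T1 = monochromatic_triples n"
  define T2 where "T2 = cyclic_triples n"
  define T3 where "T3 = {F \<in> ?all. ?X F \<in> G3}"
  define T where "T = T1 \<union> T2 \<union> T3"
  have G1: "G1 = ?X ` T1"
    using products_eq_sqfree_monos[OF assms(3), of 0] assms(4)
    by (simp add: T1_def monochromatic_triples_def)
  have G2: "G2 = ?X ` T2"
    using products_eq_sqfree_monos[OF assms(3), of 1] assms(5)
    by (simp add: T2_def cyclic_triples_def)
  have G3: "G3 = ?X ` T3"
    using assms(6) by (auto simp: T3_def sqfree_monomials_of_degree_def)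
  have sub: "T1 \<subseteq> ?all" "T2 \<subseteq> ?all" "T3 \<subseteq> ?all"
    using triples_subset[of n] by (auto simp: T1_def T2_def T3_def)
  have "inj_on ?X ?all"
    by (rule inj_on_subset[OF inj_on_sqfree_mono]) (auto intro: finite_subset)
  then have cards: "card G1 = card T1" "card G2 = card T2" "card G3 = card T3"
    unfolding G1 G2 G3 using sub by (auto intro!: card_image intro: inj_on_subset)
  have "finite ?all" by simp
  then have fin: "finite T1" "finite T2" "finite T3"
    using sub by (blast intro: finite_subset)+
  have "T1 \<inter> T2 = {}"
    using triples_disjoint by (simp add: T1_def T2_def)
  moreover have "(T1 \<union> T2) \<inter> T3 = {}"
    using assms(6) G1 G2 by (auto simp: T3_def)
  ultimately have "card T = card T1 + card T2 + card T3"
    using fin by (simp add: T_def card_Un_disjoint)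
  then have half: "2 * card T = n choose 3"
    using assms(2,7) cards by presburger
  have "f_ideal n (genideal (mpoly_ring n) (?X ` T))"
  proof (rule f_ideal_of_perfect[where d = 3])
    show "T \<subseteq> ?all"
      using sub by (simp add: T_def)
    show upper: "\<exists>t\<in>T. t \<subseteq> F" if "F \<subseteq> {1..n}" "card F = Suc 3" for F
      using four_set_contains_triple[of F n] that by (auto simp: T_def T1_def T2_def)
    show "\<exists>t\<in>T. F \<subseteq> t" if "F \<subseteq> {1..n}" "Suc (card F) = 3" for F
      using pair_extends_to_triple[OF assms(1), of F] that by (auto simp: T_def T1_def T2_def)
    have "{1..4} \<subseteq> {1..n}"
      using assms(1) by auto
    then show "T \<noteq> {}"
      using upper[of "{1..4}"] by auto
    show "2 * card T = n choose 3" by (rule half)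
  qed simp
  moreover have "?X ` T = G1 \<union> G2 \<union> G3"
    by (simp add: T_def G1 G2 G3 image_Un)
  ultimately show ?thesis by simp
qed

end
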